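(* Let $H$ be a hypergraph with $v(H)\geq 2$. Then the quotient $H/\Pi(H)$ is an empty hypergraph, a prime hypergraph, or a complete graph (i.e. $E(H/\Pi(H))=\binom{\Pi(H)}{2}$).
   Context: All structures are finite. A hypergraph $H$ consists of a vertex set $V(H)$ and an edge set $E(H)$ which is a set of subsets of $V(H)$, each having at least $2$ elements (edges may have different sizes); $v(H)=|V(H)|$. $H$ is empty if $E(H)=\emptyset$. A subset $M$ of $V(H)$ is a module of $H$ if for each $e\in E(H)$ such that $e\cap M\neq\emptyset$ and $e\setminus M\neq\emptyset$, there exists $m\in M$ such that $e\cap M=\{m\}$ and for every $n\in M$, $(e\setminus\{m\})\cup\{n\}\in E(H)$. The sets $\emptyset$, $V(H)$ and $\{v\}$ ($v\in V(H)$) are modules, called trivial. $H$ is prime if $v(H)\geq 3$ and all its modules are trivial. A module $M$ of $H$ is strong if for every module $N$ of $H$ with $M\cap N\neq\emptyset$, we have $M\subseteq N$ or $N\subseteq M$. $\Pi(H)$ denotes the set of the strong modules of $H$ distinct from $V(H)$ that are maximal under inclusion among those; when $v(H)\geq 2$, $\Pi(H)$ is a partition of $V(H)$. For a partition $P$ of $V(H)$ into modules of $H$, the quotient $H/P$ is the hypergraph with vertex set $P$ such that $\mathcal{E}\subseteq P$ is an edge of $H/P$ iff $|\mathcal{E}|\geq 2$ and there exists $e\in E(H)$ with $\mathcal{E}=\{X\in P:X\cap e\neq\emptyset\}$. *)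

theory Defs
  imports Main "HOL-Library.Disjoint_Sets"
begin

record 'a hypergraph =
  verts :: "'a set"
  edges :: "'a set set"

definition hypergraph :: "'a hypergraph \<Rightarrow> bool" where
  "hypergraph H \<longleftrightarrow>
     finite (verts H) \<and> (\<forall>e \<in> edges H. e \<subseteq> verts H \<and> card e \<ge> 2)"

definition empty_hypergraph :: "'a hypergraph \<Rightarrow> bool" where
  "empty_hypergraph H \<longleftrightarrow> edges H = {}"

definition complete_graph :: "'a hypergraph \<Rightarrow> bool" where
  "complete_graph H \<longleftrightarrow> edges H = {e. e \<subseteq> verts H \<and> card e = 2}"

definition is_module :: "'a hypergraph \<Rightarrow> 'a set \<Rightarrow> bool" where
  "is_module H M \<longleftrightarrow>
     M \<subseteq> verts H \<and>
     (\<forall>e \<in> edges H. e \<inter> M \<noteq> {} \<and> e - M \<noteq> {} \<longrightarrow>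
        (\<exists>m \<in> M. e \<inter> M = {m} \<and> (\<forall>n \<in> M. (e - {m}) \<union> {n} \<in> edges H)))"

definition trivial_module :: "'a hypergraph \<Rightarrow> 'a set \<Rightarrow> bool" where
  "trivial_module H M \<longleftrightarrow> M = {} \<or> M = verts H \<or> (\<exists>v \<in> verts H. M = {v})"

definition prime_hypergraph :: "'a hypergraph \<Rightarrow> bool" where
  "prime_hypergraph H \<longleftrightarrow>
     card (verts H) \<ge> 3 \<and> (\<forall>M. is_module H M \<longrightarrow> trivial_module H M)"

definition strong_module :: "'a hypergraph \<Rightarrow> 'a set \<Rightarrow> bool" where
  "strong_module H M \<longleftrightarrow>
     is_module H M \<and>
     (\<forall>N. is_module H N \<and> M \<inter> N \<noteq> {} \<longrightarrow> M \<subseteq> N \<or> N \<subseteq> M)"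

definition max_strong_modules :: "'a hypergraph \<Rightarrow> 'a set set" where
  "max_strong_modules H =
     {M. strong_module H M \<and> M \<noteq> verts H \<and>
         (\<forall>N. strong_module H N \<and> N \<noteq> verts H \<and> M \<subseteq> N \<longrightarrow> N = M)}"

text \<open>Intended for partitions \<open>P\<close> of the vertex set into modules; the vertices of the
  quotient are the blocks themselves, so it is a hypergraph over the type of sets.\<close>

definition quotient_hypergraph :: "'a hypergraph \<Rightarrow> 'a set set \<Rightarrow> 'a set hypergraph" where
  "quotient_hypergraph H P =
     \<lparr>verts = P,
      edges = {\<E>. \<E> \<subseteq> P \<and> card \<E> \<ge> 2 \<and>
                   (\<exists>e \<in> edges H. \<E> = {X \<in> P. X \<inter> e \<noteq> {}})}\<rparr>"

lemma hypergraph_quotient_hypergraph: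
  assumes "hypergraph H" and "partition_on (verts H) P"
  shows "hypergraph (quotient_hypergraph H P)"
  using assms finite_elements[of "verts H" P]
  by (auto simp: hypergraph_def quotient_hypergraph_def)

end

theory Submission
  imports Defs
begin

text \<open>Complementing the edges of size two preserves the modules. Call \<open>H\<close> disconnected if some
  proper nonempty vertex set is crossed by no edge. If \<open>H\<close> is disconnected, its components are
  strong modules, so no edge meets two blocks of \<open>\<Pi>(H)\<close> and the quotient is empty; if the
  complement is disconnected, the quotient is dually a complete graph. If both are connected,
  the vertex set is not the disjoint union of two nonempty modules, so no two maximal proper
  modules overlap. Hence these are strong. A module of the quotient lifts to a
  module of \<open>H\<close>, since an edge meeting two blocks may exchange its representatives one block at
  a time, and so it is trivial.\<close>

section \<open>Modules\<close>

text \<open>The witness \<open>m\<close> of the definition is forced: it is the only element of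
  \<open>e \<inter> M\<close>. The existential can therefore be traded for a quantifier over all
  \<open>x\<close> in \<open>e \<inter> M\<close>, so that no witness has to be extracted
  later.\<close>

lemma is_module_iff:
  "is_module H M \<longleftrightarrow>
     M \<subseteq> verts H \<and>
     (\<forall>e \<in> edges H. \<forall>x \<in> e \<inter> M. e - M \<noteq> {} \<longrightarrow>
        e \<inter> M = {x} \<and> (\<forall>n \<in> M. insert n (e - {x}) \<in> edges H))"
  (is "_ \<longleftrightarrow> ?R")
proof
  assume M: "is_module H M"
  show ?R
  proof (intro conjI ballI impI)
    show "M \<subseteq> verts H" using M by (simp add: is_module_def)
    fix e x assume e: "e \<in> edges H" and x: "x \<in> e \<inter> M" and ne: "e - M \<noteq> {}"
    have "e \<inter> M \<noteq> {}" using x by blast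
    with M e ne have "\<exists>m \<in> M. e \<inter> M = {m} \<and> (\<forall>n \<in> M. (e - {m}) \<union> {n} \<in> edges H)"
      unfolding is_module_def by simp
    then obtain m where m: "e \<inter> M = {m}" "\<forall>n \<in> M. (e - {m}) \<union> {n} \<in> edges H"
      by (elim bexE conjE)
    have "m = x" using m(1) x by simp
    then show "e \<inter> M = {x}" using m(1) by simp
    show "insert n (e - {x}) \<in> edges H" if "n \<in> M" for n
      using m(2) that \<open>m = x\<close> by simp
  qed
next
  assume R: ?R
  show "is_module H M" unfolding is_module_def
  proof (intro conjI ballI impI)
    show "M \<subseteq> verts H" using R by (rule conjunct1)
    fix e assume e: "e \<in> edges H" and cross: "e \<inter> M \<noteq> {} \<and> e - M \<noteq> {}"
    then obtain x where x: "x \<in> e \<inter> M" by blast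
    from R[THEN conjunct2, THEN bspec, OF e, THEN bspec, OF x] cross
    have "e \<inter> M = {x}" "\<forall>n \<in> M. insert n (e - {x}) \<in> edges H" by simp_all
    then show "\<exists>m \<in> M. e \<inter> M = {m} \<and> (\<forall>n \<in> M. (e - {m}) \<union> {n} \<in> edges H)"
      using IntD2[OF x] by (intro bexI[of _ x]) simp_all
  qed
qed

lemma is_module_subset: "is_module H M \<Longrightarrow> M \<subseteq> verts H"
  by (simp add: is_module_def)

text \<open>Elimination form in which \<open>x\<close> and \<open>y\<close> certify that
  \<open>e\<close> crosses \<open>M\<close>. Nearly every exchange of one vertex for another below
  goes through it.\<close>

lemma is_module_crossing:
  assumes "is_module H M" "e \<in> edges H" "x \<in> e" "x \<in> M" "y \<in> e" "y \<notin> M"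
  shows "e \<inter> M = {x}" and "\<And>n. n \<in> M \<Longrightarrow> insert n (e - {x}) \<in> edges H"
proof -
  have x: "x \<in> e \<inter> M" and ne: "e - M \<noteq> {}" using assms(3-6) by blast+
  have "\<forall>e \<in> edges H. \<forall>x \<in> e \<inter> M. e - M \<noteq> {} \<longrightarrow>
      e \<inter> M = {x} \<and> (\<forall>n \<in> M. insert n (e - {x}) \<in> edges H)"
    using assms(1) unfolding is_module_iff by (rule conjunct2)
  from this[THEN bspec, OF assms(2), THEN bspec, OF x] ne
  have *: "e \<inter> M = {x} \<and> (\<forall>n \<in> M. insert n (e - {x}) \<in> edges H)" by (rule mp)
  then show "e \<inter> M = {x}" by simp
  show "insert n (e - {x}) \<in> edges H" if "n \<in> M" for n using * that by simp
qed

lemma is_moduleI: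
  assumes "M \<subseteq> verts H"
    and "\<And>e x y. e \<in> edges H \<Longrightarrow> x \<in> e \<Longrightarrow> x \<in> M \<Longrightarrow> y \<in> e \<Longrightarrow> y \<notin> M \<Longrightarrow>
           e \<inter> M = {x} \<and> (\<forall>n \<in> M. insert n (e - {x}) \<in> edges H)"
  shows "is_module H M"
  unfolding is_module_iff
proof (intro conjI ballI impI assms(1))
  fix e x assume "e \<in> edges H" "x \<in> e \<inter> M" "e - M \<noteq> {}"
  moreover from this obtain y where "y \<in> e" "y \<notin> M" by blast
  ultimately have *: "e \<inter> M = {x} \<and> (\<forall>n \<in> M. insert n (e - {x}) \<in> edges H)"
    using assms(2)[of e x y] by simp
  then show "e \<inter> M = {x}" by simp
  show "insert n (e - {x}) \<in> edges H" if "n \<in> M" for n using * that by simp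
qed

section \<open>Closure properties of modules\<close>

lemma is_module_singleton: "v \<in> verts H \<Longrightarrow> is_module H {v}"
  by (auto simp: is_module_def insert_absorb)

text \<open>A common point \<open>z\<close> carries exchanges from one module to the other: an edge
  crossing the union at \<open>x\<close> in \<open>M\<close> may exchange \<open>x\<close> for
  \<open>z\<close>, and the resulting edge crosses \<open>N\<close> at \<open>z\<close>, which may
  then be exchanged for any point of \<open>N\<close>.\<close>

lemma is_module_Un:
  assumes M: "is_module H M" and N: "is_module H N" and "M \<inter> N \<noteq> {}"
  shows "is_module H (M \<union> N)"
proof -
  \<comment> \<open>Stated for arbitrary \<open>M'\<close> and \<open>N'\<close>, so that the case
    where \<open>x\<close> lies in \<open>N\<close> follows by swapping the roles.\<close>
  have *: "e \<inter> (M' \<union> N') = {x} \<and> (\<forall>n \<in> M' \<union> N'. insert n (e - {x}) \<in> edges H)"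
    if M': "is_module H M'" and N': "is_module H N'" and ne: "M' \<inter> N' \<noteq> {}"
      and e: "e \<in> edges H" "x \<in> e" "x \<in> M'" "y \<in> e" "y \<notin> M' \<union> N'" for M' N' e x y
  proof -
    obtain z where z: "z \<in> M'" "z \<in> N'" using ne by blast
    have eM: "e \<inter> M' = {x}" "\<And>n. n \<in> M' \<Longrightarrow> insert n (e - {x}) \<in> edges H"
      using is_module_crossing[OF M' e(1,2,3,4)] e(5) by blast+
    let ?f = "insert z (e - {x})"
    have f: "?f \<in> edges H" "y \<in> ?f" "y \<notin> N'" using eM(2) z e by auto
    have fN: "?f \<inter> N' = {z}" "\<And>n. n \<in> N' \<Longrightarrow> insert n (?f - {z}) \<in> edges H"
      using is_module_crossing[OF N' f(1) _ z(2) f(2,3)] by blast+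
    \<comment> \<open>A second point \<open>w\<close> would survive the exchange of \<open>x\<close>
      for \<open>z\<close>, and \<open>?f\<close> would meet \<open>N'\<close> in both
      \<open>w\<close> and \<open>z\<close>.\<close>
    have "w = x" if w: "w \<in> e" "w \<in> M' \<union> N'" for w
    proof (rule ccontr)
      assume "w \<noteq> x"
      then have "w \<notin> M'" "w \<in> ?f" using eM(1) w(1) by auto
      then have "w \<in> ?f \<inter> N'" using w(2) by blast
      then show False using fN(1) z(1) \<open>w \<notin> M'\<close> by simp
    qed
    then have *: "e \<inter> (M' \<union> N') = {x}" using e(2,3) by blast
    \<comment> \<open>Exchanging \<open>z\<close> for \<open>n\<close> in \<open>?f\<close> thus
      amounts to exchanging \<open>x\<close> for \<open>n\<close> in \<open>e\<close>.\<close>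
    have "z \<notin> e - {x}" using eM(1) z(1) by auto
    then have "?f - {z} = e - {x}" by auto
    with eM(2) fN(2) have "insert n (e - {x}) \<in> edges H" if "n \<in> M' \<union> N'" for n
      using that by auto
    with * show ?thesis by simp
  qed
  show ?thesis
  proof (rule is_moduleI)
    show "M \<union> N \<subseteq> verts H" using M N is_module_subset by blast
    fix e x y assume e: "e \<in> edges H" "x \<in> e" "x \<in> M \<union> N" "y \<in> e" "y \<notin> M \<union> N"
    show "e \<inter> (M \<union> N) = {x} \<and> (\<forall>n \<in> M \<union> N. insert n (e - {x}) \<in> edges H)"
    proof (cases "x \<in> M")
      case True
      then show ?thesis using *[OF M N assms(3) e(1,2) _ e(4,5)] by metis
    next
      case False
      then have "x \<in> N" "N \<inter> M \<noteq> {}" "y \<notin> N \<union> M" using e assms(3) by auto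
      then have "e \<inter> (N \<union> M) = {x} \<and> (\<forall>n \<in> N \<union> M. insert n (e - {x}) \<in> edges H)"
        using *[OF N M _ e(1,2) _ e(4)] by metis
      then show ?thesis unfolding Un_commute[of M N] .
    qed
  qed
qed

text \<open>An edge leaving \<open>N\<close> is handled by \<open>N\<close> alone. An edge inside
  \<open>N\<close> crosses \<open>M\<close> at \<open>y\<close>; moving \<open>y\<close> to a point
  \<open>p\<close> of \<open>M\<close> outside \<open>N\<close> makes it cross \<open>N\<close>,
  which forces the edge to be the pair \<open>{x, y}\<close>. Then \<open>x\<close> is exchanged for
  \<open>n\<close> and \<open>p\<close> is moved back to \<open>y\<close>.\<close>

lemma is_module_Diff:
  assumes M: "is_module H M" and N: "is_module H N" and "\<not> M \<subseteq> N"
  shows "is_module H (N - M)"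
proof (rule is_moduleI)
  show "N - M \<subseteq> verts H" using N is_module_subset by blast
  fix e x y assume e: "e \<in> edges H" "x \<in> e" "x \<in> N - M" "y \<in> e" "y \<notin> N - M"
  show "e \<inter> (N - M) = {x} \<and> (\<forall>n \<in> N - M. insert n (e - {x}) \<in> edges H)"
  proof (cases "e \<subseteq> N")
    case False
    then obtain z where "z \<in> e" "z \<notin> N" by blast
    then show ?thesis using is_module_crossing[OF N e(1,2)] e(2,3) by blast
  next
    case True
    obtain p where p: "p \<in> M" "p \<notin> N" using assms(3) by blast
    have y: "y \<in> M" "x \<notin> M" using True e by auto
    have eM: "e \<inter> M = {y}" "insert p (e - {y}) \<in> edges H"
      using is_module_crossing[OF M e(1,4) y(1) e(2) y(2)] p by blast+
    have fN: "insert p (e - {y}) \<inter> N = {x}"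
      "\<And>n. n \<in> N \<Longrightarrow> insert n (insert p (e - {y}) - {x}) \<in> edges H"
      using is_module_crossing[OF N eM(2), of x p] p e y by blast+
    \<comment> \<open>All of \<open>e\<close> except \<open>y\<close> survives the move to
      \<open>p\<close> and lies in \<open>N\<close>, where only \<open>x\<close> is left.\<close>
    have exy: "e = {x, y}" using fN(1) True eM(1) e by blast
    have "insert n (e - {x}) \<in> edges H" if n: "n \<in> N - M" for n
    proof -
      have "insert n (insert p (e - {y}) - {x}) = {n, p}" using exy p e by auto
      then have "{n, p} \<in> edges H" using fN(2) n by force
      then have "insert y ({n, p} - {p}) \<in> edges H"
        using is_module_crossing(2)[OF M _ _ p(1), of "{n, p}" n y] n y by blast
      moreover have "insert y ({n, p} - {p}) = insert n (e - {x})" using exy y n p by auto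
      ultimately show ?thesis by simp
    qed
    with exy e y show ?thesis by blast
  qed
qed

section \<open>Complementation and connectedness\<close>

text \<open>The complement graph, applied to the edges of size two only. Complementing larger sizes
  would not preserve modules, since a new edge could cross a module in two points.\<close>

definition compl_hypergraph :: "'a hypergraph \<Rightarrow> 'a hypergraph" where
  "compl_hypergraph H =
     \<lparr>verts = verts H,
      edges = {e \<in> edges H. card e \<noteq> 2} \<union> {e. e \<subseteq> verts H \<and> card e = 2 \<and> e \<notin> edges H}\<rparr>"

lemma verts_compl_hypergraph [simp]: "verts (compl_hypergraph H) = verts H"
  by (simp add: compl_hypergraph_def)

lemma hypergraph_compl_hypergraph: "hypergraph H \<Longrightarrow> hypergraph (compl_hypergraph H)"
  by (auto simp: hypergraph_def compl_hypergraph_def)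

lemma compl_hypergraph_involutive:
  "hypergraph H \<Longrightarrow> compl_hypergraph (compl_hypergraph H) = H"
  by (cases H) (auto simp: hypergraph_def compl_hypergraph_def)

text \<open>Exchanges preserve the size of a crossing edge, so edges of other sizes are exchanged as
  in \<open>H\<close>. For a new pair \<open>{x, y}\<close>, if \<open>{n, y}\<close> were an edge
  of \<open>H\<close>, exchanging \<open>n\<close> back for \<open>x\<close> would make
  \<open>{x, y}\<close> one as well.\<close>

lemma is_module_compl_hypergraph:
  assumes H: "hypergraph H" and M: "is_module H M"
  shows "is_module (compl_hypergraph H) M"
proof (rule is_moduleI)
  show MV: "M \<subseteq> verts (compl_hypergraph H)" using is_module_subset[OF M] by simp
  fix e x y
  assume e: "e \<in> edges (compl_hypergraph H)" and xy: "x \<in> e" "x \<in> M" "y \<in> e" "y \<notin> M"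
  show "e \<inter> M = {x} \<and> (\<forall>n \<in> M. insert n (e - {x}) \<in> edges (compl_hypergraph H))"
  proof (cases "e \<in> edges H")
    case True
    have fin: "finite e" using True H by (meson finite_subset hypergraph_def)
    have c: "card e \<noteq> 2" using True e by (auto simp: compl_hypergraph_def)
    note eM = is_module_crossing[OF M True xy]
    have "card (insert n (e - {x})) = card e" if "n \<in> M" for n
    proof -
      have "n \<notin> e - {x}" using eM(1) that by blast
      then show ?thesis
        using fin xy(1) by (metis card.remove card_insert_disjoint finite_Diff)
    qed
    with c eM show ?thesis by (auto simp: compl_hypergraph_def)
  next
    case False
    then have "card e = 2" and eV: "e \<subseteq> verts H" using e by (auto simp: compl_hypergraph_def)
    then have exy: "e = {x, y}" using xy by (auto simp: card_2_iff)
    have "insert n (e - {x}) \<in> edges (compl_hypergraph H)" if n: "n \<in> M" for n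
    proof -
      have eq: "insert n (e - {x}) = {n, y}" using exy xy by auto
      have "{n, y} \<notin> edges H"
      proof
        assume "{n, y} \<in> edges H"
        then have "insert x ({n, y} - {n}) \<in> edges H"
          using is_module_crossing(2)[OF M _ _ n, of "{n, y}" y x] xy by blast
        moreover have "insert x ({n, y} - {n}) = e" using exy n xy by auto
        ultimately show False using False by simp
      qed
      moreover have "n \<noteq> y" using n xy by blast
      ultimately show ?thesis using eq MV n eV xy by (auto simp: compl_hypergraph_def)
    qed
    then show ?thesis using exy xy by auto
  qed
qed

lemma is_module_compl_hypergraph_iff:
  "hypergraph H \<Longrightarrow> is_module (compl_hypergraph H) M \<longleftrightarrow> is_module H M"
  using is_module_compl_hypergraph[of H M]
    is_module_compl_hypergraph[OF hypergraph_compl_hypergraph, of H M]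
  by (auto simp: compl_hypergraph_involutive)

text \<open>Strength and maximality depend only on the vertex set and the modules. Results on a
  disconnected hypergraph thus apply to the complement with the same blocks.\<close>

lemma max_strong_modules_compl_hypergraph:
  "hypergraph H \<Longrightarrow> max_strong_modules (compl_hypergraph H) = max_strong_modules H"
  by (simp add: max_strong_modules_def strong_module_def is_module_compl_hypergraph_iff)

section \<open>Separated sets and connected components\<close>

definition separated :: "'a hypergraph \<Rightarrow> 'a set \<Rightarrow> bool" where
  "separated H S \<longleftrightarrow> S \<subseteq> verts H \<and> (\<forall>e \<in> edges H. e \<subseteq> S \<or> e \<inter> S = {})"

text \<open>Connectedness is expressed by cuts instead of paths, so that components arise as minimal
  nonempty separated sets.\<close>

definition disconnected :: "'a hypergraph \<Rightarrow> bool" where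
  "disconnected H \<longleftrightarrow> (\<exists>S. separated H S \<and> S \<noteq> {} \<and> S \<noteq> verts H)"

lemma separated_Diff:
  assumes "separated H S" "separated H T"
  shows "separated H (S - T)"
  using assms unfolding separated_def by blast

lemma is_module_separated: "separated H S \<Longrightarrow> is_module H S"
  unfolding is_module_def separated_def by blast

text \<open>The component \<open>C\<close> of a vertex of \<open>e\<close> is strong: if a module
  \<open>N\<close> overlapped it, then by minimality some edge inside \<open>C\<close> would cross
  \<open>C \<inter> N\<close>, and exchanging its point in \<open>N\<close> for a point of
  \<open>N\<close> outside \<open>C\<close> would give an edge leaving \<open>C\<close>.\<close>

lemma disconnected_edge_in_strong_module:
  assumes H: "hypergraph H" and disc: "disconnected H" and e: "e \<in> edges H"
  shows "\<exists>C. strong_module H C \<and> C \<noteq> verts H \<and> e \<subseteq> C"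
proof -
  have eV: "e \<subseteq> verts H" and "e \<noteq> {}" using H e by (auto simp: hypergraph_def)
  then obtain v where v: "v \<in> e" by blast
  have sepV: "separated H (verts H)" using H by (auto simp: separated_def hypergraph_def)
  \<comment> \<open>The component of \<open>v\<close>. The family is nonempty, because the whole
    vertex set is separated.\<close>
  define C where "C = \<Inter>{S. separated H S \<and> v \<in> S}"
  have vC: "v \<in> C" by (auto simp: C_def)
  have least: "C \<subseteq> S" if "separated H S" "v \<in> S" for S using that by (auto simp: C_def)
  have CV: "C \<subseteq> verts H" using least[OF sepV] v eV by blast
  have sepC: "separated H C" unfolding separated_def
  proof (intro conjI ballI CV)
    fix f assume f: "f \<in> edges H"
    have "f \<subseteq> S" if "separated H S" "v \<in> S" "f \<inter> C \<noteq> {}" for S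
      using that(1) f least[OF that(1,2)] that(3) unfolding separated_def by blast
    then show "f \<subseteq> C \<or> f \<inter> C = {}"
      unfolding C_def by blast
  qed
  \<comment> \<open>If \<open>S\<close> missed \<open>v\<close>, then \<open>C - S\<close> would be
    a smaller separated set around \<open>v\<close>.\<close>
  have minimal: "S = C" if S: "separated H S" "S \<subseteq> C" "S \<noteq> {}" for S
  proof (cases "v \<in> S")
    case True
    then show ?thesis using least[OF S(1)] S(2) by blast
  next
    case False
    then have "C \<subseteq> C - S" using least[OF separated_Diff[OF sepC S(1)]] vC by blast
    then show ?thesis using S(2,3) by blast
  qed
  have "strong_module H C" unfolding strong_module_def
  proof (intro conjI allI impI)
    show "is_module H C" using sepC by (rule is_module_separated)
    fix N assume N: "is_module H N \<and> C \<inter> N \<noteq> {}"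
    show "C \<subseteq> N \<or> N \<subseteq> C"
    proof (rule ccontr)
      assume nt: "\<not> (C \<subseteq> N \<or> N \<subseteq> C)"
      then have "\<not> separated H (C \<inter> N)" using minimal[of "C \<inter> N"] N by blast
      then obtain f x y where f: "f \<in> edges H" "x \<in> f" "x \<in> C" "x \<in> N" "y \<in> f" "y \<notin> C \<inter> N"
        using CV unfolding separated_def by blast
      have fC: "f \<subseteq> C" using sepC f unfolding separated_def by blast
      then have y: "y \<in> C" "y \<notin> N" using f by auto
      obtain n where n: "n \<in> N" "n \<notin> C" using nt by blast
      have "insert n (f - {x}) \<in> edges H"
        using is_module_crossing(2)[of H N f x y n] N f y n by blast
      moreover have "y \<in> insert n (f - {x})" using f y by blast
      ultimately have "insert n (f - {x}) \<subseteq> C"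
        using sepC y(1) unfolding separated_def by (meson disjoint_iff)
      then show False using n(2) by simp
    qed
  qed
  moreover have "C \<noteq> verts H"
  proof
    assume CV': "C = verts H"
    obtain S where "separated H S" "S \<noteq> {}" "S \<noteq> verts H"
      using disc by (auto simp: disconnected_def)
    moreover then have "S \<subseteq> verts H" by (simp add: separated_def)
    ultimately show False using minimal[of S] CV' by blast
  qed
  moreover have "e \<subseteq> C" using sepC e v vC unfolding separated_def by blast
  ultimately show ?thesis by blast
qed

text \<open>If some edge joins \<open>A\<close> to \<open>B\<close>, exchanges on both sides turn it
  into every pair between them. Any edge joining them is such a pair, so all of these disappear in
  the complement and \<open>A\<close> becomes separated there.\<close>

lemma disconnected_if_complementary_modules:
  assumes H: "hypergraph H" and A: "is_module H A" and B: "is_module H B"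
    and ne: "A \<noteq> {}" "B \<noteq> {}" and AB: "A \<inter> B = {}" "A \<union> B = verts H"
  shows "disconnected H \<or> disconnected (compl_hypergraph H)"
proof (cases "separated H A")
  case True
  then show ?thesis using ne AB unfolding disconnected_def by blast
next
  case False
  \<comment> \<open>An edge meeting both sides crosses both modules, hence has exactly one vertex in
    each.\<close>
  have pair: "f = {a, b}"
    if "f \<in> edges H" "a \<in> f" "a \<in> A" "b \<in> f" "b \<in> B" for f a b
  proof -
    have "f \<inter> A = {a}" "f \<inter> B = {b}"
      using is_module_crossing(1)[OF A, of f a b] is_module_crossing(1)[OF B, of f b a] that AB
      by blast+
    moreover have "f \<subseteq> A \<union> B" using H that AB by (auto simp: hypergraph_def)
    ultimately show ?thesis by blast
  qed
  obtain e a b where e: "e \<in> edges H" "a \<in> e" "a \<in> A" "b \<in> e" "b \<notin> A"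
    using False AB unfolding separated_def by blast
  have b: "b \<in> B" using e H AB by (auto simp: hypergraph_def)
  have ab: "{a, b} \<in> edges H" using pair[of e a b] e b by simp
  have all: "{x, y} \<in> edges H" if "x \<in> A" "y \<in> B" for x y
  proof -
    have "insert x ({a, b} - {a}) \<in> edges H"
      using is_module_crossing(2)[OF A ab, of a b x] e that by blast
    moreover have "insert x ({a, b} - {a}) = {x, b}" using e by auto
    ultimately have xb: "{x, b} \<in> edges H" by simp
    have "insert y ({x, b} - {b}) \<in> edges H"
      using is_module_crossing(2)[OF B xb, of b x y] b that AB by blast
    moreover have "insert y ({x, b} - {b}) = {x, y}" using b that AB by auto
    ultimately show ?thesis by simp
  qed
  have "separated (compl_hypergraph H) A" unfolding separated_def
  proof (intro conjI ballI)
    show "A \<subseteq> verts (compl_hypergraph H)" using AB by auto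
    fix f assume f: "f \<in> edges (compl_hypergraph H)"
    show "f \<subseteq> A \<or> f \<inter> A = {}"
    proof (rule ccontr)
      assume "\<not> (f \<subseteq> A \<or> f \<inter> A = {})"
      then obtain x y where xy: "x \<in> f" "x \<in> A" "y \<in> f" "y \<notin> A" by blast
      have "f \<subseteq> verts H"
        using f hypergraph_compl_hypergraph[OF H] by (auto simp: hypergraph_def)
      then have y: "y \<in> B" using AB xy by blast
      then have "x \<noteq> y" using xy by blast
      \<comment> \<open>An edge kept from \<open>H\<close> would be a pair by \<open>pair\<close>,
        yet pairs of \<open>H\<close> are removed; a newly added pair is already in \<open>H\<close>
        by \<open>all\<close>.\<close>
      show False
      proof (cases "f \<in> edges H")
        case True
        then have "card f = 2" using pair[OF True] xy y \<open>x \<noteq> y\<close> by (metis card_2_iff)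
        then show False using True f by (auto simp: compl_hypergraph_def)
      next
        case False
        then have "card f = 2" using f by (auto simp: compl_hypergraph_def)
        then have "f = {x, y}" using xy \<open>x \<noteq> y\<close> by (auto simp: card_2_iff)
        then show False using all xy y False by blast
      qed
    qed
  qed
  then show ?thesis using ne AB unfolding disconnected_def verts_compl_hypergraph by blast
qed

section \<open>Maximal strong modules\<close>

lemma strong_module_in_max_strong_module:
  assumes H: "hypergraph H" and S: "strong_module H S" "S \<noteq> verts H"
  shows "\<exists>X \<in> max_strong_modules H. S \<subseteq> X"
proof -
  let ?F = "{M. strong_module H M \<and> M \<noteq> verts H}"
  have "?F \<subseteq> Pow (verts H)" by (auto simp: strong_module_def is_module_def)
  then have "finite ?F"
    using H by (meson finite_Pow_iff finite_subset hypergraph_def)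
  then obtain X where "X \<in> ?F" "S \<subseteq> X" "\<forall>N \<in> ?F. X \<subseteq> N \<longrightarrow> N = X"
    using finite_has_maximal2[of ?F S] S by auto
  moreover from this have "X \<in> max_strong_modules H" by (simp add: max_strong_modules_def)
  ultimately show ?thesis by metis
qed

lemma strong_module_singleton: "v \<in> verts H \<Longrightarrow> strong_module H {v}"
  by (auto simp: strong_module_def is_module_singleton)

text \<open>Singletons are strong and, with two vertices available, proper, so the blocks cover.
  Blocks that meet are comparable by strength and then equal by maximality.\<close>

lemma partition_on_max_strong_modules:
  assumes H: "hypergraph H" and c: "card (verts H) \<ge> 2"
  shows "partition_on (verts H) (max_strong_modules H)"
proof (rule partition_onI)
  have cover: "\<exists>X \<in> max_strong_modules H. v \<in> X" if "v \<in> verts H" for v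
  proof -
    have "card {v} \<noteq> card (verts H)" using c by simp
    then have "{v} \<noteq> verts H" by metis
    then obtain X where "X \<in> max_strong_modules H" "{v} \<subseteq> X"
      using strong_module_in_max_strong_module[OF H strong_module_singleton[OF \<open>v \<in> verts H\<close>]] by blast
    then show ?thesis by blast
  qed
  have "X \<subseteq> verts H" if "X \<in> max_strong_modules H" for X
    using that by (simp add: max_strong_modules_def strong_module_def is_module_def)
  then show "\<Union> (max_strong_modules H) = verts H" using cover by blast
  show "disjnt X Y" if "X \<in> max_strong_modules H" "Y \<in> max_strong_modules H" "X \<noteq> Y" for X Y
  proof (rule ccontr)
    assume "\<not> disjnt X Y"
    moreover have "strong_module H X" "is_module H Y"
      using that(1,2) by (simp_all add: max_strong_modules_def strong_module_def)
    ultimately have "X \<subseteq> Y \<or> Y \<subseteq> X"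
      unfolding strong_module_def disjnt_def by metis
    then show False using that by (auto simp: max_strong_modules_def)
  qed
  show "{} \<notin> max_strong_modules H"
  proof
    assume X: "{} \<in> max_strong_modules H"
    \<comment> \<open>The block around any vertex strictly contains the empty set, which is
      therefore not maximal.\<close>
    obtain v where "v \<in> verts H" using c by fastforce
    then obtain Y where "Y \<in> max_strong_modules H" "v \<in> Y" using cover by blast
    then show False using X unfolding max_strong_modules_def by blast
  qed
qed

lemma max_strong_module_is_module: "X \<in> max_strong_modules H \<Longrightarrow> is_module H X"
  by (simp add: max_strong_modules_def strong_module_def)

lemma disconnected_edge_in_max_strong_module:
  assumes "hypergraph H" "disconnected H" "e \<in> edges H"
  shows "\<exists>X \<in> max_strong_modules H. e \<subseteq> X"
proof -
  obtain C where C: "strong_module H C" "C \<noteq> verts H" "e \<subseteq> C"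
    using disconnected_edge_in_strong_module[OF assms] by blast
  then obtain X where "X \<in> max_strong_modules H" "C \<subseteq> X"
    using strong_module_in_max_strong_module[OF assms(1)] by blast
  then show ?thesis using C(3) by blast
qed

text \<open>A maximal proper module \<open>X\<close> above \<open>N\<close> is strong: if
  \<open>M\<close> overlapped it, \<open>X \<union> M\<close> would be a larger module, hence
  everything, and \<open>X\<close> and \<open>M - X\<close> would be complementary modules,
  contradicting connectedness.\<close>

lemma proper_module_in_max_strong_module:
  assumes H: "hypergraph H" and con: "\<not> disconnected H" "\<not> disconnected (compl_hypergraph H)"
    and N: "is_module H N" "N \<noteq> verts H"
  shows "\<exists>X \<in> max_strong_modules H. N \<subseteq> X"
proof -
  let ?F = "{M. is_module H M \<and> M \<noteq> verts H}"
  have "?F \<subseteq> Pow (verts H)" by (auto simp: is_module_def)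
  then have "finite ?F"
    using H by (meson finite_Pow_iff finite_subset hypergraph_def)
  then obtain X where X: "X \<in> ?F" "N \<subseteq> X" and max: "\<And>M. M \<in> ?F \<Longrightarrow> X \<subseteq> M \<Longrightarrow> M = X"
    using finite_has_maximal2[of ?F N] N by auto
  have "strong_module H X" unfolding strong_module_def
  proof (intro conjI allI impI)
    show "is_module H X" using X by simp
    fix M assume M: "is_module H M \<and> X \<inter> M \<noteq> {}"
    show "X \<subseteq> M \<or> M \<subseteq> X"
    proof (rule ccontr)
      assume nt: "\<not> (X \<subseteq> M \<or> M \<subseteq> X)"
      have "is_module H (X \<union> M)" using is_module_Un X M by blast
      then have V: "X \<union> M = verts H" using max[of "X \<union> M"] nt by blast
      have "is_module H (M - X)" using is_module_Diff X M nt by blast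
      then show False
        using disconnected_if_complementary_modules[OF H, of X "M - X"] X M V nt con by blast
    qed
  qed
  then obtain Y where "Y \<in> max_strong_modules H" "X \<subseteq> Y"
    using strong_module_in_max_strong_module[OF H, of X] X(1) by blast
  then show ?thesis using X(2) by blast
qed

section \<open>Quotients\<close>

text \<open>Each vertex \<open>a\<close> of \<open>e\<close> outside \<open>f\<close> is exchanged,
  within its block, for the vertex of \<open>f\<close> there, which lowers
  \<open>card (e - f)\<close>. Once \<open>e \<subseteq> f\<close>, both are equal, because
  \<open>f\<close> has at most one vertex per block and \<open>e\<close> meets the same
  blocks.\<close>

lemma transversal_edge:
  assumes H: "hypergraph H" and P: "partition_on (verts H) P"
    and mod: "\<And>X. X \<in> P \<Longrightarrow> is_module H X"
    and f: "f \<subseteq> verts H" "\<And>X a b. X \<in> P \<Longrightarrow> a \<in> X \<Longrightarrow> b \<in> X \<Longrightarrow> a \<in> f \<Longrightarrow> b \<in> f \<Longrightarrow> a = b"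
    and e: "e \<in> edges H" "\<And>X. X \<in> P \<Longrightarrow> X \<inter> e \<noteq> {} \<longleftrightarrow> X \<inter> f \<noteq> {}"
      "\<And>X. X \<in> P \<Longrightarrow> \<not> e \<subseteq> X"
  shows "f \<in> edges H"
  using e
proof (induction "card (e - f)" arbitrary: e rule: less_induct)
  case less
  have eV: "e \<subseteq> verts H" and fin: "finite e"
    using H less.prems(1) by (auto simp: hypergraph_def intro: finite_subset)
  have block: "\<exists>X \<in> P. x \<in> X" if "x \<in> verts H" for x
    using P that by (auto simp: partition_on_def)
  show ?case
  proof (cases "e \<subseteq> f")
    case True
    have "y \<in> e" if y: "y \<in> f" for y
    proof -
      obtain X where X: "X \<in> P" "y \<in> X" using block y f(1) by blast
      then obtain z where "z \<in> X" "z \<in> e" using less.prems(2)[of X] y by blast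
      then show ?thesis using f(2) X y True by blast
    qed
    then show ?thesis using True less.prems(1) by (metis subsetI subset_antisym)
  next
    case False
    then obtain a where a: "a \<in> e" "a \<notin> f" by blast
    obtain X where X: "X \<in> P" "a \<in> X" using block a eV by blast
    obtain b where b: "b \<in> X" "b \<in> f" using less.prems(2)[of X] X a by blast
    \<comment> \<open>This is where \<open>e\<close> not lying in one block is used:
      \<open>c\<close> makes \<open>e\<close> cross \<open>X\<close>. It also stays in the new edge,
      which again lies in no single block.\<close>
    obtain c where c: "c \<in> e" "c \<notin> X" using less.prems(3)[of X] X by blast
    note cross = is_module_crossing[OF mod[OF X(1)] less.prems(1) a(1) X(2) c]
    let ?e = "insert b (e - {a})"
    show ?thesis
    proof (rule less.hyps)
      have "?e - f = (e - f) - {a}" using b(2) by auto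
      then show "card (?e - f) < card (e - f)" using fin a by (metis DiffI card_Diff1_less finite_Diff)
      show "?e \<in> edges H" using cross(2) b by blast
      have disj: "Y = X" if "Y \<in> P" "x \<in> Y" "x \<in> X" for Y x
        using P X(1) that by (auto simp: partition_on_def disjoint_def)
      show "Y \<inter> ?e \<noteq> {} \<longleftrightarrow> Y \<inter> f \<noteq> {}" if Y: "Y \<in> P" for Y
      proof (cases "Y = X")
        case True
        then show ?thesis using b by blast
      next
        case False
        then have "a \<notin> Y" "b \<notin> Y" using disj Y X b by blast+
        then show ?thesis using less.prems(2)[OF Y] by blast
      qed
      show "\<not> ?e \<subseteq> Y" if Y: "Y \<in> P" for Y
        using disj[OF Y _ b(1)] c X by blast
    qed
  qed
qed

text \<open>The blocks met by a crossing edge \<open>e\<close> form a quotient edge crossing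
  \<open>M\<close>. Exchanging the block of \<open>x\<close> for that of \<open>n\<close> there
  yields some edge \<open>g\<close> of \<open>H\<close> with the right blocks but arbitrary
  representatives; \<open>transversal_edge\<close> then replaces these by the vertices of
  \<open>insert n (e - {x})\<close>.\<close>

lemma is_module_Union_quotient:
  assumes H: "hypergraph H" and P: "partition_on (verts H) P"
    and mod: "\<And>X. X \<in> P \<Longrightarrow> is_module H X"
    and M: "is_module (quotient_hypergraph H P) M"
  shows "is_module H (\<Union> M)"
proof (rule is_moduleI)
  let ?Q = "quotient_hypergraph H P"
  have MP: "M \<subseteq> P" using is_module_subset[OF M] by (simp add: quotient_hypergraph_def)
  show UV: "\<Union> M \<subseteq> verts H" using MP P by (auto simp: partition_on_def)
  fix e x y assume e: "e \<in> edges H" "x \<in> e" "x \<in> \<Union> M" "y \<in> e" "y \<notin> \<Union> M"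
  have disj: "Z = Z'" if "Z \<in> P" "Z' \<in> P" "z \<in> Z" "z \<in> Z'" for Z Z' z
    using P that by (auto simp: partition_on_def disjoint_def)
  have block: "\<exists>X \<in> P. z \<in> X" if "z \<in> verts H" for z
    using P that by (auto simp: partition_on_def)
  have eV: "e \<subseteq> verts H" using H e by (auto simp: hypergraph_def)
  have finP: "finite P" using H P finite_elements by (auto simp: hypergraph_def)
  obtain X where X: "X \<in> M" "x \<in> X" using e by blast
  obtain Y where Y: "Y \<in> P" "y \<in> Y" using block e eV by blast
  have XP: "X \<in> P" using X MP by blast
  have YM: "Y \<notin> M" using Y e by blast
  then have "X \<noteq> Y" using X by blast
  let ?E = "{Z \<in> P. Z \<inter> e \<noteq> {}}"
  have XE: "X \<in> ?E" and YE: "Y \<in> ?E" using XP X Y e by blast+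
  then have "{X, Y} \<subseteq> ?E" by simp
  then have "card ?E \<ge> 2"
    using finP \<open>X \<noteq> Y\<close> card_mono[of ?E "{X, Y}"] by simp
  then have E: "?E \<in> edges ?Q" using e by (auto simp: quotient_hypergraph_def)
  have EM: "?E \<inter> M = {X}" "\<And>Z. Z \<in> M \<Longrightarrow> insert Z (?E - {X}) \<in> edges ?Q"
    using is_module_crossing[OF M E XE X(1) YE YM] by simp_all
  have yX: "y \<notin> X" using e X by blast
  note eX = is_module_crossing[OF mod[OF XP] e(1,2) X(2) e(4) yX]
  \<comment> \<open>As \<open>x\<close> and \<open>y\<close> lie in different blocks, no block
    contains \<open>e\<close>; each block met by \<open>e\<close> is crossed, hence met only
    once.\<close>
  have trans: "a = b" if Z: "Z \<in> P" "a \<in> Z" "b \<in> Z" "a \<in> e" "b \<in> e" for Z a b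
  proof -
    have "\<exists>c \<in> e. c \<notin> Z" using disj[OF XP Z(1) X(2)] e(2,4) yX by blast
    then show ?thesis using is_module_crossing(1)[OF mod[OF Z(1)] e(1)] Z by blast
  qed
  have "e \<inter> \<Union> M = {x}" using EM(1) eX(1) MP e by blast
  moreover have "insert n (e - {x}) \<in> edges H" if n: "n \<in> \<Union> M" for n
  proof -
    obtain Z where Z: "Z \<in> M" "n \<in> Z" using n by blast
    then have ZP: "Z \<in> P" using MP by blast
    show ?thesis
    proof (cases "Z = X")
      case True
      then show ?thesis using eX(2) Z by blast
    next
      case False
      \<comment> \<open>\<open>X\<close> is the only block of \<open>M\<close> that \<open>e\<close>
        meets, so adding \<open>n\<close> puts no second vertex into \<open>Z\<close>.\<close>
      then have ZE: "Z \<notin> ?E" using EM(1) Z by blast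
      obtain g where g: "g \<in> edges H" "insert Z (?E - {X}) = {W \<in> P. W \<inter> g \<noteq> {}}"
        using EM(2)[OF Z(1)] by (auto simp: quotient_hypergraph_def)
      have meets: "W \<inter> g \<noteq> {} \<longleftrightarrow> W = Z \<or> W \<noteq> X \<and> W \<inter> e \<noteq> {}" if W: "W \<in> P" for W
      proof -
        have "W \<inter> g \<noteq> {} \<longleftrightarrow> W \<in> insert Z (?E - {X})" unfolding g(2) using W by simp
        then show ?thesis using W by auto
      qed
      show ?thesis
      proof (rule transversal_edge[OF H P mod _ _ g(1)])
        show "insert n (e - {x}) \<subseteq> verts H" using eV n UV by blast
        show "a = b" if "W \<in> P" "a \<in> W" "b \<in> W" "a \<in> insert n (e - {x})"
          "b \<in> insert n (e - {x})" for W a b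
        proof -
          have "W = Z" if "n \<in> W" using disj[OF \<open>W \<in> P\<close> ZP that Z(2)] .
          then show ?thesis using ZE ZP trans[of W a b] that by blast
        qed
        show "W \<inter> g \<noteq> {} \<longleftrightarrow> W \<inter> insert n (e - {x}) \<noteq> {}" if W: "W \<in> P" for W
        proof -
          have nW: "n \<in> W \<longleftrightarrow> W = Z" using disj[OF W ZP _ Z(2)] Z(2) by blast
          \<comment> \<open>Since \<open>e\<close> meets \<open>X\<close> in \<open>x\<close> alone,
            deleting \<open>x\<close> removes exactly \<open>X\<close> from the blocks met.\<close>
          have "W \<noteq> X \<and> W \<inter> e \<noteq> {} \<longleftrightarrow> W \<inter> (e - {x}) \<noteq> {}"
          proof (cases "W = X")
            case True
            then show ?thesis using eX(1) by auto
          next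
            case False
            then have "x \<notin> W" using disj[OF W XP _ X(2)] by blast
            then show ?thesis using False by auto
          qed
          then show ?thesis unfolding meets[OF W] using nW by auto
        qed
        show "\<not> g \<subseteq> W" if W: "W \<in> P" for W
        proof
          assume gW: "g \<subseteq> W"
          \<comment> \<open>\<open>Y\<close> lies outside \<open>M\<close> and \<open>Z\<close>
            inside, so \<open>g\<close> meets two different blocks.\<close>
          have "Y \<inter> g \<noteq> {}" "Z \<inter> g \<noteq> {}"
            using meets[OF Y(1)] meets[OF ZP] YE \<open>X \<noteq> Y\<close> by simp_all
          then have "W = Y" "W = Z" using disj[OF W Y(1)] disj[OF W ZP] gW by blast+
          then show False using YM Z by simp
        qed
      qed
    qed
  qed
  ultimately show "e \<inter> \<Union> M = {x} \<and> (\<forall>n \<in> \<Union> M. insert n (e - {x}) \<in> edges H)" by blast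
qed

section \<open>The three possible quotients\<close>

lemma quotient_edgeE:
  assumes "\<E> \<in> edges (quotient_hypergraph H P)"
  obtains e X Y where "e \<in> edges H" "\<E> = {Z \<in> P. Z \<inter> e \<noteq> {}}"
    "X \<in> P" "Y \<in> P" "X \<noteq> Y" "X \<inter> e \<noteq> {}" "Y \<inter> e \<noteq> {}"
proof -
  obtain e where e: "e \<in> edges H" "\<E> = {Z \<in> P. Z \<inter> e \<noteq> {}}" and "card \<E> \<ge> 2"
    using assms by (auto simp: quotient_hypergraph_def)
  then obtain T where "T \<subseteq> \<E>" "card T = 2" by (meson obtain_subset_with_card_n)
  then obtain X Y where "X \<in> \<E>" "Y \<in> \<E>" "X \<noteq> Y" by (auto simp: card_2_iff)
  with e that[of e X Y] show ?thesis by simp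
qed

text \<open>A quotient edge comes from an edge meeting two blocks, but every edge stays inside one
  block.\<close>

lemma quotient_empty_if_disconnected:
  assumes H: "hypergraph H" "card (verts H) \<ge> 2" and disc: "disconnected H"
  shows "empty_hypergraph (quotient_hypergraph H (max_strong_modules H))"
proof -
  let ?P = "max_strong_modules H"
  have "\<E> \<notin> edges (quotient_hypergraph H ?P)" for \<E>
  proof
    assume "\<E> \<in> edges (quotient_hypergraph H ?P)"
    then obtain e X Y where e: "e \<in> edges H" and XY: "X \<in> ?P" "Y \<in> ?P" "X \<noteq> Y"
      "X \<inter> e \<noteq> {}" "Y \<inter> e \<noteq> {}" by (rule quotient_edgeE)
    obtain Z where "Z \<in> ?P" "e \<subseteq> Z"
      using disconnected_edge_in_max_strong_module[OF H(1) disc e] by blast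
    moreover have "disjoint ?P"
      using partition_on_max_strong_modules[OF H] by (simp add: partition_on_def)
    ultimately have "X = Z" "Y = Z" using XY unfolding disjoint_def by blast+
    then show False using XY by simp
  qed
  then show ?thesis by (auto simp: empty_hypergraph_def)
qed

text \<open>Edges of the complement stay inside blocks. Hence an edge of \<open>H\<close> meeting
  two blocks was removed by complementation and is a pair, and conversely any pair of vertices from
  two blocks, not being in the complement, is an edge of \<open>H\<close>.\<close>

lemma quotient_complete_if_compl_disconnected:
  assumes H: "hypergraph H" "card (verts H) \<ge> 2" and disc: "disconnected (compl_hypergraph H)"
  shows "complete_graph (quotient_hypergraph H (max_strong_modules H))"
proof -
  let ?P = "max_strong_modules H" and ?Q = "quotient_hypergraph H (max_strong_modules H)"
  have P: "partition_on (verts H) ?P" using partition_on_max_strong_modules[OF H] .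
  have disj: "X = Y" if "X \<in> ?P" "Y \<in> ?P" "z \<in> X" "z \<in> Y" for X Y z
    using P that by (auto simp: partition_on_def disjoint_def)
  have within: "\<exists>X \<in> ?P. e \<subseteq> X" if "e \<in> edges (compl_hypergraph H)" for e
    using disconnected_edge_in_max_strong_module[OF hypergraph_compl_hypergraph[OF H(1)] disc that]
    by (simp add: max_strong_modules_compl_hypergraph[OF H(1)])
  have "card \<E> = 2" if E: "\<E> \<in> edges ?Q" for \<E>
  proof -
    obtain e X Y where e: "e \<in> edges H" "\<E> = {Z \<in> ?P. Z \<inter> e \<noteq> {}}" and
      XY: "X \<in> ?P" "Y \<in> ?P" "X \<noteq> Y" "X \<inter> e \<noteq> {}" "Y \<inter> e \<noteq> {}"
      using E by (rule quotient_edgeE)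
    obtain x y where xy: "x \<in> X" "x \<in> e" "y \<in> Y" "y \<in> e" using XY(4,5) by blast
    \<comment> \<open>A block containing \<open>e\<close> would coincide with both \<open>X\<close>
      and \<open>Y\<close>.\<close>
    have "Z = X \<and> Z = Y" if "Z \<in> ?P" "e \<subseteq> Z" for Z
      using disj[OF that(1) XY(1) _ xy(1)] disj[OF that(1) XY(2) _ xy(3)] that(2) xy(2,4)
      by (simp add: subset_iff)
    then have "\<not> (\<exists>Z \<in> ?P. e \<subseteq> Z)" using XY(3) by metis
    then have "e \<notin> edges (compl_hypergraph H)" using within by blast
    then have "card e = 2" using e by (auto simp: compl_hypergraph_def)
    moreover have "x \<noteq> y" using disj[OF XY(1,2) xy(1)] XY(3) xy(3) by metis
    ultimately have "e = {x, y}" using xy(2,4) by (auto simp: card_2_iff)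
    then have "Z \<inter> e \<noteq> {} \<longleftrightarrow> Z = X \<or> Z = Y" if "Z \<in> ?P" for Z
      using disj[OF that XY(1) _ xy(1)] disj[OF that XY(2) _ xy(3)] xy(1,3) by blast
    then have "\<E> = {X, Y}" unfolding e(2) using XY(1,2) by blast
    then show ?thesis using XY by simp
  qed
  moreover have "\<E> \<in> edges ?Q" if E: "\<E> \<subseteq> ?P" "card \<E> = 2" for \<E>
  proof -
    obtain X Y where XY: "\<E> = {X, Y}" "X \<noteq> Y" using E by (auto simp: card_2_iff)
    then have XYP: "X \<in> ?P" "Y \<in> ?P" using E by auto
    then have "X \<noteq> {}" "Y \<noteq> {}" using P by (auto simp: partition_on_def)
    then obtain x y where xy: "x \<in> X" "y \<in> Y" by blast
    have "x \<noteq> y" using disj[OF XYP xy(1)] XY(2) xy(2) by metis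
    have "x \<in> verts H" "y \<in> verts H" using P XYP xy by (auto simp: partition_on_def)
    moreover have "Z = X \<and> Z = Y" if "Z \<in> ?P" "{x, y} \<subseteq> Z" for Z
      using disj[OF that(1) XYP(1) _ xy(1)] disj[OF that(1) XYP(2) _ xy(2)] that(2) by simp
    then have "\<not> (\<exists>Z \<in> ?P. {x, y} \<subseteq> Z)" using XY(2) by metis
    then have "{x, y} \<notin> edges (compl_hypergraph H)" using within by blast
    ultimately have "{x, y} \<in> edges H" using \<open>x \<noteq> y\<close> by (auto simp: compl_hypergraph_def)
    moreover have "\<E> = {Z \<in> ?P. Z \<inter> {x, y} \<noteq> {}}"
    proof -
      have "Z \<inter> {x, y} \<noteq> {} \<longleftrightarrow> Z = X \<or> Z = Y" if "Z \<in> ?P" for Z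
        using disj[OF that XYP(1) _ xy(1)] disj[OF that XYP(2) _ xy(2)] xy by blast
      then show ?thesis unfolding XY(1) using XYP by blast
    qed
    ultimately have "\<exists>e \<in> edges H. \<E> = {Z \<in> ?P. Z \<inter> e \<noteq> {}}" by (rule bexI[rotated])
    then show ?thesis using E by (simp add: quotient_hypergraph_def)
  qed
  moreover have "\<E> \<subseteq> ?P" if "\<E> \<in> edges ?Q" for \<E>
    using that by (simp add: quotient_hypergraph_def)
  ultimately have "edges ?Q = {\<E>. \<E> \<subseteq> ?P \<and> card \<E> = 2}" by blast
  then show ?thesis by (simp add: complete_graph_def quotient_hypergraph_def)
qed

text \<open>The union of a quotient module is a module of \<open>H\<close>. If it is proper, it fits
  into one block, which leaves at most one member; otherwise every block must belong to the quotient
  module.\<close>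

lemma quotient_prime_if_connected:
  assumes H: "hypergraph H" "card (verts H) \<ge> 2"
    and con: "\<not> disconnected H" "\<not> disconnected (compl_hypergraph H)"
  shows "prime_hypergraph (quotient_hypergraph H (max_strong_modules H))"
proof -
  let ?P = "max_strong_modules H" and ?Q = "quotient_hypergraph H (max_strong_modules H)"
  have P: "partition_on (verts H) ?P" using partition_on_max_strong_modules[OF H] .
  have VQ: "verts ?Q = ?P" by (simp add: quotient_hypergraph_def)
  have disj: "X = Y" if "X \<in> ?P" "Y \<in> ?P" "z \<in> X" "z \<in> Y" for X Y z
    using P that by (auto simp: partition_on_def disjoint_def)
  have ne: "X \<noteq> {}" if "X \<in> ?P" for X using P that by (auto simp: partition_on_def)
  have UP: "\<Union> ?P = verts H" using P by (simp add: partition_on_def)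
  have proper: "X \<noteq> verts H" if "X \<in> ?P" for X using that by (simp add: max_strong_modules_def)
  have finP: "finite ?P" using H P finite_elements by (auto simp: hypergraph_def)
  have "card ?P \<noteq> 0" using UP H(2) finP by auto
  moreover have "card ?P \<noteq> 1"
  proof
    assume "card ?P = 1"
    then obtain X where "?P = {X}" by (auto simp: card_1_singleton_iff)
    then show False using UP proper[of X] by simp
  qed
  \<comment> \<open>Two blocks would be complementary modules, which connectedness of
    \<open>H\<close> and of its complement rules out.\<close>
  moreover have "card ?P \<noteq> 2"
  proof
    assume "card ?P = 2"
    then obtain A B where AB: "?P = {A, B}" "A \<noteq> B" by (auto simp: card_2_iff)
    then have "A \<inter> B = {}" "A \<union> B = verts H" using disj[of A B] UP by auto
    moreover have "is_module H A" "is_module H B" "A \<noteq> {}" "B \<noteq> {}"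
      using AB(1) max_strong_module_is_module[of _ H] ne by auto
    ultimately show False using disconnected_if_complementary_modules[OF H(1)] con by blast
  qed
  ultimately have "card ?P \<ge> 3" by arith
  then have "card (verts ?Q) \<ge> 3" using VQ by simp
  moreover have "trivial_module ?Q M" if M: "is_module ?Q M" for M
  proof (cases "\<Union> M = verts H")
    case True
    have MP: "M \<subseteq> ?P" using is_module_subset[OF M] VQ by simp
    have "X \<in> M" if X: "X \<in> ?P" for X
    proof -
      obtain x where x: "x \<in> X" using ne X by blast
      then obtain Y where "Y \<in> M" "x \<in> Y" using True UP X by blast
      then show ?thesis using disj[of X Y x] X x MP by blast
    qed
    then have "M = ?P" using MP by blast
    then show ?thesis by (simp add: trivial_module_def VQ)
  next
    case False
    have MP: "M \<subseteq> ?P" using is_module_subset[OF M] VQ by simp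
    have "is_module H (\<Union> M)"
      using is_module_Union_quotient[OF H(1) P max_strong_module_is_module M] .
    then obtain X where X: "X \<in> ?P" "\<Union> M \<subseteq> X"
      using proper_module_in_max_strong_module[OF H(1) con _ False] by blast
    have "Y = X" if Y: "Y \<in> M" for Y
    proof -
      obtain y where "y \<in> Y" using ne[of Y] Y MP by blast
      then show ?thesis using disj[of Y X y] X Y MP by blast
    qed
    then have "M = {} \<or> M = {X}" by blast
    then show ?thesis using X VQ by (auto simp: trivial_module_def)
  qed
  ultimately show ?thesis by (simp add: prime_hypergraph_def)
qed

theorem theorem7:
  fixes H :: "'a hypergraph"
  assumes "hypergraph H" and "card (verts H) \<ge> 2"
  shows "empty_hypergraph (quotient_hypergraph H (max_strong_modules H)) \<or>
         prime_hypergraph (quotient_hypergraph H (max_strong_modules H)) \<or>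
         complete_graph (quotient_hypergraph H (max_strong_modules H))"
  using quotient_empty_if_disconnected[OF assms] quotient_prime_if_connected[OF assms]
    quotient_complete_if_compl_disconnected[OF assms] by blast

end
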